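(* Let $H\in(\tfrac12,1)$, $\sigma>0$. Then $\mathcal{Y}_n^H\to\mathcal{Y}_H$ in distribution as $n\to\infty$.
   Context: $c_H=\sqrt{\frac{2H\,\Gamma(\frac32-H)}{\Gamma(H+\frac12)\Gamma(2-2H)}}$, $C_H=c_H(H-\frac12)$, $g_H=\frac{\sigma c_H}{H+\frac12}$, $h=\frac H2+\frac14$, $\rho_h(k)=\frac12((k+1)^{2h}+(k-1)^{2h}-2k^{2h})$, and for $1\le i<n$, $j_n^H(i)=\sigma C_H\int_{i-1}^i x^{\frac12-H}\Big(\int_0^1(v+n-1)^{H-\frac12}(v+n-1-x)^{H-\frac32}dv\Big)dx$. Let $(\xi_i)_{i\ge1}$ be i.i.d. with $P(\xi_i=\pm1)=\frac12$, $\mathcal{Y}_n^H=\sum_{i=1}^{n-1}j_n^H(i)\xi_i$, and $\mathcal{Y}_H=2g_H\sum_{k=1}^\infty\rho_h(k)\xi_k$ (almost surely convergent). *)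

theory Defs
  imports "HOL-Probability.Probability"
begin

definition c_H :: "real \<Rightarrow> real" where
  "c_H H = sqrt (2 * H * Gamma (3/2 - H) / (Gamma (H + 1/2) * Gamma (2 - 2*H)))"

definition C_H :: "real \<Rightarrow> real" where
  "C_H H = c_H H * (H - 1/2)"

definition g_H :: "real \<Rightarrow> real \<Rightarrow> real" where
  "g_H \<sigma> H = \<sigma> * c_H H / (H + 1/2)"

definition h_of :: "real \<Rightarrow> real" where
  "h_of H = H / 2 + 1/4"

definition rho :: "real \<Rightarrow> nat \<Rightarrow> real" where
  "rho h k = ((real k + 1) powr (2*h) + (real k - 1) powr (2*h) - 2 * real k powr (2*h)) / 2"

definition j_coef :: "real \<Rightarrow> real \<Rightarrow> nat \<Rightarrow> nat \<Rightarrow> real" where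
  "j_coef \<sigma> H n i = \<sigma> * C_H H *
     (LBINT x = real i - 1 .. real i. x powr (1/2 - H) *
        (LBINT v = 0 .. 1. (v + real n - 1) powr (H - 1/2) * (v + real n - 1 - x) powr (H - 3/2)))"

definition Y_n :: "real \<Rightarrow> real \<Rightarrow> (nat \<Rightarrow> 'a \<Rightarrow> real) \<Rightarrow> nat \<Rightarrow> 'a \<Rightarrow> real" where
  "Y_n \<sigma> H \<xi> n \<omega> = (\<Sum>i = 1..<n. j_coef \<sigma> H n i * \<xi> i \<omega>)"

text \<open>Limit variable: 2 g_H sum_{k>=1} rho_h(k) xi_k (the series converges a.s.)\<close>
definition Y_lim :: "real \<Rightarrow> real \<Rightarrow> (nat \<Rightarrow> 'a \<Rightarrow> real) \<Rightarrow> 'a \<Rightarrow> real" where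
  "Y_lim \<sigma> H \<xi> \<omega> = 2 * g_H \<sigma> H * (\<Sum>k. rho (h_of H) (Suc k) * \<xi> (Suc k) \<omega>)"

end

theory Submission
  imports Defs "HOL-Real_Asymp.Real_Asymp"
begin

text \<open>
  Put $a = H - 1/2$. The coefficient of index $n - k$ in the $n$-th sum converges, for fixed $k$, to the
  $k$-th coefficient of the limit series, so the time-reversed sums converge coefficientwise. The
  uniform bound $j_n(n-k) \le K n^a (n-k)^{-a} k^{a-1}$ upgrades this to $\sum_{k<n} |j_n(n-k)^2 - c_k^2|
  \to 0$: dominated convergence covers $2k \le n$, and the squares with $2k > n$ contribute
  $O(n^{2a-1})$. The characteristic function of a Rademacher sum is a product of cosines; it does not
  depend on the order of the coefficients, and since $|\cos x - \cos y| \le |x^2 - y^2|/2$ the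
  characteristic functions of the two sums have the same limit. The limit series converges almost
  surely by Kolmogorov's maximal inequality, and Levy's continuity theorem concludes.
\<close>

section \<open>Almost sure convergence of random series\<close>

context prob_space
begin

text \<open>Functions of disjoint blocks of an independent family are independent. The past enters
  through an arbitrary measurable \<open>f\<close>, because the maximal inequality needs a
  first-passage event there and not only a partial sum.\<close>

lemma indep_var_past_future:
  fixes X :: "nat \<Rightarrow> 'a \<Rightarrow> real"
  assumes "indep_vars (\<lambda>_. borel) X UNIV" and "f \<in> borel_measurable (PiM {m..<k} (\<lambda>_. borel))"
  shows "indep_var borel (\<lambda>\<omega>. f (\<lambda>i\<in>{m..<k}. X i \<omega>)) borel (\<lambda>\<omega>. \<Sum>i=k..<n. X i \<omega>)"
proof -
  have "indep_var borel (f \<circ> (\<lambda>\<omega>. \<lambda>i\<in>{m..<k}. X i \<omega>))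
      borel ((\<lambda>x. \<Sum>i=k..<n. x i) \<circ> (\<lambda>\<omega>. \<lambda>i\<in>{k..<n}. X i \<omega>))"
    by (intro indep_var_compose[OF indep_var_restrict[OF assms(1)]]) (use assms(2) in auto)
  then show ?thesis by (simp add: comp_def)
qed

text \<open>Independent centred variables are orthogonal: in the induction on \<open>n\<close> the
  cross term between the old sum and the new summand has mean zero.\<close>

lemma expectation_sum_square_indep:
  fixes X :: "nat \<Rightarrow> 'a \<Rightarrow> real"
  assumes indep: "indep_vars (\<lambda>_. borel) X UNIV"
    and sq: "\<And>i. integrable M (\<lambda>\<omega>. (X i \<omega>)\<^sup>2)"
    and mean: "\<And>i. expectation (X i) = 0"
  shows "integrable M (\<lambda>\<omega>. (\<Sum>i=m..<n. X i \<omega>)\<^sup>2)"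
    and "expectation (\<lambda>\<omega>. (\<Sum>i=m..<n. X i \<omega>)\<^sup>2) = (\<Sum>i=m..<n. expectation (\<lambda>\<omega>. (X i \<omega>)\<^sup>2))"
proof -
  have rv [measurable]: "\<And>i. random_variable borel (X i)"
    using indep by (auto simp: indep_vars_def)
  have int: "\<And>i. integrable M (X i)"
    by (rule square_integrable_imp_integrable[OF rv sq])
  have "integrable M (\<lambda>\<omega>. (\<Sum>i=m..<n. X i \<omega>)\<^sup>2) \<and>
    expectation (\<lambda>\<omega>. (\<Sum>i=m..<n. X i \<omega>)\<^sup>2) = (\<Sum>i=m..<n. expectation (\<lambda>\<omega>. (X i \<omega>)\<^sup>2))"
  proof (induction n)
    case (Suc n)
    show ?case
    proof (cases "m \<le> n")
      case True
      have ind: "indep_var borel (\<lambda>\<omega>. \<Sum>i=m..<n. X i \<omega>) borel (X n)"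
        using indep_var_past_future[OF indep, of "\<lambda>x. \<Sum>i=m..<n. x i" m n "Suc n"] by simp
      have prod: "integrable M (\<lambda>\<omega>. (\<Sum>i=m..<n. X i \<omega>) * X n \<omega>)"
        "expectation (\<lambda>\<omega>. (\<Sum>i=m..<n. X i \<omega>) * X n \<omega>) = 0"
        using indep_var_integrable[OF ind] indep_var_lebesgue_integral[OF ind] int mean by auto
      have eq: "(\<lambda>\<omega>. (\<Sum>i=m..<Suc n. X i \<omega>)\<^sup>2) =
        (\<lambda>\<omega>. ((\<Sum>i=m..<n. X i \<omega>)\<^sup>2 + 2 * ((\<Sum>i=m..<n. X i \<omega>) * X n \<omega>)) + (X n \<omega>)\<^sup>2)"
        using True by (simp add: power2_sum algebra_simps)
      show ?thesis unfolding eq using Suc.IH prod sq[of n] True by simp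
    qed simp
  qed simp
  then show "integrable M (\<lambda>\<omega>. (\<Sum>i=m..<n. X i \<omega>)\<^sup>2)"
    "expectation (\<lambda>\<omega>. (\<Sum>i=m..<n. X i \<omega>)\<^sup>2) = (\<Sum>i=m..<n. expectation (\<lambda>\<omega>. (X i \<omega>)\<^sup>2))"
    by auto
qed

text \<open>The event splits according to the first index \<open>k\<close> at which the partial sum
  reaches \<open>\<epsilon>\<close> in absolute value. On \<open>A k\<close> the final sum is T_k
  plus a remainder R. Since 1_{A_k} T_k depends on the past only, its product with R has mean zero,
  so the second moment of the final sum over \<open>A k\<close> is at least
  \<open>\<epsilon>\<^sup>2 * prob (A k)\<close>.\<close>

lemma Kolmogorov_maximal_inequality:
  fixes X :: "nat \<Rightarrow> 'a \<Rightarrow> real"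
  assumes indep: "indep_vars (\<lambda>_. borel) X UNIV"
    and sq: "\<And>i. integrable M (\<lambda>\<omega>. (X i \<omega>)\<^sup>2)"
    and mean: "\<And>i. expectation (X i) = 0"
    and "\<epsilon> > 0"
  shows "prob {\<omega> \<in> space M. \<exists>k\<in>{m..n}. \<epsilon> \<le> \<bar>\<Sum>i=m..<k. X i \<omega>\<bar>}
    \<le> (\<Sum>i=m..<n. expectation (\<lambda>\<omega>. (X i \<omega>)\<^sup>2)) / \<epsilon>\<^sup>2"
proof -
  have rv [measurable]: "\<And>i. random_variable borel (X i)"
    using indep by (auto simp: indep_vars_def)
  have int: "\<And>i. integrable M (X i)"
    by (rule square_integrable_imp_integrable[OF rv sq])
  define T where "T = (\<lambda>k \<omega>. \<Sum>i=m..<k. X i \<omega>)"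
  have [measurable]: "\<And>k. random_variable borel (T k)"
    unfolding T_def by measurable
  have intT2: "integrable M (\<lambda>\<omega>. (T k \<omega>)\<^sup>2)" for k
    unfolding T_def by (rule expectation_sum_square_indep(1)[OF indep sq mean])
  have intT: "integrable M (T k)" for k
    unfolding T_def by (intro Bochner_Integration.integrable_sum int)
  define A where "A = (\<lambda>k. {\<omega> \<in> space M. \<epsilon> \<le> \<bar>T k \<omega>\<bar> \<and> (\<forall>j\<in>{m..<k}. \<bar>T j \<omega>\<bar> < \<epsilon>)})"
  have [measurable]: "A k \<in> events" for k
    unfolding A_def by measurable
  have step: "\<epsilon>\<^sup>2 * prob (A k) \<le> expectation (\<lambda>\<omega>. indicator (A k) \<omega> * (T n \<omega>)\<^sup>2)"
    if k: "k \<in> {m..n}" for k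
  proof -
    define R where "R = (\<lambda>\<omega>. \<Sum>i=k..<n. X i \<omega>)"
    \<comment> \<open>Capping the index at \<open>k\<close> makes every \<open>s j\<close> a
      function of the coordinates in \<open>{m..<k}\<close> alone, so that \<open>f\<close> is
      measurable on that product space. Composed with the restricted variables, \<open>f\<close>
      gives 1_{A_k} T_k.\<close>
    define s where "s = (\<lambda>j (x :: nat \<Rightarrow> real). \<Sum>i=m..<min j k. x i)"
    define f where "f = (\<lambda>x. if \<epsilon> \<le> \<bar>s k x\<bar> \<and> (\<forall>j\<in>{m..<k}. \<bar>s j x\<bar> < \<epsilon>) then s k x else 0)"
    have [measurable]: "s j \<in> borel_measurable (PiM {m..<k} (\<lambda>_. borel))" for j
      unfolding s_def by (intro borel_measurable_sum measurable_component_singleton) auto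
    have "f \<in> borel_measurable (PiM {m..<k} (\<lambda>_. borel))"
      unfolding f_def by measurable
    then have ind: "indep_var borel (\<lambda>\<omega>. f (\<lambda>i\<in>{m..<k}. X i \<omega>)) borel R"
      unfolding R_def by (rule indep_var_past_future[OF indep])
    have f_eq: "f (\<lambda>i\<in>{m..<k}. X i \<omega>) = indicator (A k) \<omega> * T k \<omega>" if "\<omega> \<in> space M" for \<omega>
    proof -
      have "s j (\<lambda>i\<in>{m..<k}. X i \<omega>) = T j \<omega>" if "j \<le> k" for j
        unfolding T_def s_def using that by (intro sum.cong) auto
      then show ?thesis
        using that unfolding f_def A_def by (auto simp: indicator_def)
    qed
    have intf: "integrable M (\<lambda>\<omega>. f (\<lambda>i\<in>{m..<k}. X i \<omega>))"
      using integrable_real_mult_indicator[OF _ intT[of k], of "A k"]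
      by (subst Bochner_Integration.integrable_cong[OF refl f_eq]) (auto simp: mult.commute)
    have intR: "integrable M R" "expectation R = 0"
      unfolding R_def using int mean by (auto intro!: Bochner_Integration.integrable_sum)
    have cross: "integrable M (\<lambda>\<omega>. indicator (A k) \<omega> * T k \<omega> * R \<omega>)"
      "expectation (\<lambda>\<omega>. indicator (A k) \<omega> * T k \<omega> * R \<omega>) = 0"
    proof -
      have "integrable M (\<lambda>\<omega>. f (\<lambda>i\<in>{m..<k}. X i \<omega>) * R \<omega>)"
        "expectation (\<lambda>\<omega>. f (\<lambda>i\<in>{m..<k}. X i \<omega>) * R \<omega>) = 0"
        using indep_var_integrable[OF ind intf intR(1)]
          indep_var_lebesgue_integral[OF ind intf intR(1)] intR(2) by auto
      then show "integrable M (\<lambda>\<omega>. indicator (A k) \<omega> * T k \<omega> * R \<omega>)"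
        "expectation (\<lambda>\<omega>. indicator (A k) \<omega> * T k \<omega> * R \<omega>) = 0"
        by (simp_all add: f_eq cong: Bochner_Integration.integrable_cong Bochner_Integration.integral_cong)
    qed
    have split: "T n \<omega> = T k \<omega> + R \<omega>" for \<omega>
      unfolding T_def R_def using k by (simp add: sum.atLeastLessThan_concat)
    have intA: "integrable M (indicat_real (A k))"
      by (intro integrable_real_indicator) (auto simp: emeasure_eq_measure)
    have "\<epsilon>\<^sup>2 * prob (A k) = expectation (\<lambda>\<omega>. \<epsilon>\<^sup>2 * indicator (A k) \<omega> + 2 * (indicator (A k) \<omega> * T k \<omega> * R \<omega>))"
      using cross intA by (subst Bochner_Integration.integral_add) auto
    also have "\<dots> \<le> expectation (\<lambda>\<omega>. indicator (A k) \<omega> * (T n \<omega>)\<^sup>2)"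
    proof (rule integral_mono)
      show "integrable M (\<lambda>\<omega>. \<epsilon>\<^sup>2 * indicator (A k) \<omega> + 2 * (indicator (A k) \<omega> * T k \<omega> * R \<omega>))"
        using cross intA by auto
      show "integrable M (\<lambda>\<omega>. indicator (A k) \<omega> * (T n \<omega>)\<^sup>2)"
        using integrable_real_mult_indicator[OF _ intT2[of n], of "A k"] by (simp add: mult.commute)
      show "\<epsilon>\<^sup>2 * indicator (A k) \<omega> + 2 * (indicator (A k) \<omega> * T k \<omega> * R \<omega>)
          \<le> indicator (A k) \<omega> * (T n \<omega>)\<^sup>2" for \<omega>
      proof (cases "\<omega> \<in> A k")
        case True
        then have "\<epsilon>\<^sup>2 \<le> \<bar>T k \<omega>\<bar>\<^sup>2"
          using \<open>\<epsilon> > 0\<close> by (intro power_mono) (auto simp: A_def)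
        \<comment> \<open>In the expansion of (T_k + R)^2 the square of R is nonnegative, and the
          cross term is the one that integrates to zero.\<close>
        then have "\<epsilon>\<^sup>2 \<le> (T k \<omega>)\<^sup>2 + (R \<omega>)\<^sup>2" by (simp add: add_increasing2)
        then show ?thesis using True by (simp add: split power2_sum)
      qed simp
    qed
    finally show ?thesis .
  qed
  have disj: "disjoint_family_on A {m..n}"
    unfolding disjoint_family_on_def
  proof (intro ballI impI)
    fix a b assume "a \<in> {m..n}" "b \<in> {m..n}" "a \<noteq> b"
    then show "A a \<inter> A b = {}"
      by (cases a b rule: linorder_cases) (auto simp: A_def dest!: bspec)
  qed
  have Un: "{\<omega> \<in> space M. \<exists>k\<in>{m..n}. \<epsilon> \<le> \<bar>T k \<omega>\<bar>} = (\<Union>k\<in>{m..n}. A k)" (is "?L = ?R")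
  proof (intro equalityI subsetI)
    fix \<omega> assume \<omega>: "\<omega> \<in> ?L"
    define k where "k = (LEAST k. k \<in> {m..n} \<and> \<epsilon> \<le> \<bar>T k \<omega>\<bar>)"
    have "\<exists>k. k \<in> {m..n} \<and> \<epsilon> \<le> \<bar>T k \<omega>\<bar>" using \<omega> by auto
    from LeastI_ex[OF this] have k: "k \<in> {m..n}" "\<epsilon> \<le> \<bar>T k \<omega>\<bar>" unfolding k_def by auto
    have "\<bar>T j \<omega>\<bar> < \<epsilon>" if "j \<in> {m..<k}" for j
      using not_less_Least[of j "\<lambda>k. k \<in> {m..n} \<and> \<epsilon> \<le> \<bar>T k \<omega>\<bar>"] that k unfolding k_def[symmetric] by auto
    then show "\<omega> \<in> ?R" using k \<omega> by (auto simp: A_def)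
  qed (auto simp: A_def)
  have "\<epsilon>\<^sup>2 * prob ?L = (\<Sum>k\<in>{m..n}. \<epsilon>\<^sup>2 * prob (A k))"
    unfolding Un using disj by (subst finite_measure_finite_Union) (auto simp: sum_distrib_left)
  also have "\<dots> \<le> (\<Sum>k\<in>{m..n}. expectation (\<lambda>\<omega>. indicator (A k) \<omega> * (T n \<omega>)\<^sup>2))"
    by (rule sum_mono) (rule step)
  also have "\<dots> = expectation (\<lambda>\<omega>. \<Sum>k\<in>{m..n}. indicator (A k) \<omega> * (T n \<omega>)\<^sup>2)"
    using integrable_real_mult_indicator[OF _ intT2[of n]]
    by (subst Bochner_Integration.integral_sum) (auto simp: mult.commute)
  also have "\<dots> \<le> expectation (\<lambda>\<omega>. (T n \<omega>)\<^sup>2)"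
  proof (rule integral_mono)
    show "integrable M (\<lambda>\<omega>. \<Sum>k\<in>{m..n}. indicator (A k) \<omega> * (T n \<omega>)\<^sup>2)"
      using integrable_real_mult_indicator[OF _ intT2[of n]]
      by (intro Bochner_Integration.integrable_sum) (auto simp: mult.commute)
    show "(\<Sum>k\<in>{m..n}. indicator (A k) \<omega> * (T n \<omega>)\<^sup>2) \<le> (T n \<omega>)\<^sup>2" for \<omega>
    proof -
      have "(\<Sum>k\<in>{m..n}. indicator (A k) \<omega> :: real) = indicator (\<Union>k\<in>{m..n}. A k) \<omega>"
        using disj by (subst indicator_UN_disjoint) auto
      also have "\<dots> \<le> 1" by (simp add: indicator_def)
      finally show ?thesis
        unfolding sum_distrib_right[symmetric] by (intro mult_left_le_one_le) (auto simp: sum_nonneg)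
    qed
  qed (rule intT2)
  also have "\<dots> = (\<Sum>i=m..<n. expectation (\<lambda>\<omega>. (X i \<omega>)\<^sup>2))"
    unfolding T_def by (rule expectation_sum_square_indep(2)[OF indep sq mean])
  finally show ?thesis
    using \<open>\<epsilon> > 0\<close> unfolding T_def by (simp add: field_simps)
qed

text \<open>The maximal inequality bounds the probability that the partial sums started at
  \<open>m\<close> ever leave the \<epsilon>-ball by a tail of the variance series. The tails tend
  to zero, which makes the partial sums almost surely Cauchy.\<close>

lemma AE_summable_indep:
  fixes X :: "nat \<Rightarrow> 'a \<Rightarrow> real"
  assumes indep: "indep_vars (\<lambda>_. borel) X UNIV"
    and sq: "\<And>i. integrable M (\<lambda>\<omega>. (X i \<omega>)\<^sup>2)"
    and mean: "\<And>i. expectation (X i) = 0"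
    and summable: "summable (\<lambda>i. expectation (\<lambda>\<omega>. (X i \<omega>)\<^sup>2))"
  shows "AE \<omega> in M. summable (\<lambda>i. X i \<omega>)"
proof -
  have rv [measurable]: "\<And>i. random_variable borel (X i)"
    using indep by (auto simp: indep_vars_def)
  define v where "v = (\<lambda>i. expectation (\<lambda>\<omega>. (X i \<omega>)\<^sup>2))"
  have v0: "v i \<ge> 0" for i unfolding v_def by simp
  have sv: "summable v" using summable unfolding v_def .
  have tail: "AE \<omega> in M. \<exists>m. \<forall>k\<ge>m. \<bar>\<Sum>i=m..<k. X i \<omega>\<bar> < \<epsilon>" if "\<epsilon> > 0" for \<epsilon>
  proof -
    define B where "B = (\<lambda>m. {\<omega> \<in> space M. \<exists>k\<ge>m. \<epsilon> \<le> \<bar>\<Sum>i=m..<k. X i \<omega>\<bar>})"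
    have [measurable]: "B m \<in> events" for m unfolding B_def by measurable
    have B: "prob (B m) \<le> (suminf v - (\<Sum>i<m. v i)) / \<epsilon>\<^sup>2" for m
    proof -
      \<comment> \<open>The maximal inequality concerns finitely many indices. These events increase
        to \<open>B m\<close>, so a bound uniform in \<open>n\<close> passes to the limit by
        continuity of measure.\<close>
      define C where "C = (\<lambda>n. {\<omega> \<in> space M. \<exists>k\<in>{m..n}. \<epsilon> \<le> \<bar>\<Sum>i=m..<k. X i \<omega>\<bar>})"
      have "range C \<subseteq> events" unfolding C_def by auto
      moreover have "incseq C" unfolding C_def incseq_def by fastforce
      ultimately have "(\<lambda>n. prob (C n)) \<longlonglongrightarrow> prob (\<Union>n. C n)"
        by (rule finite_Lim_measure_incseq)
      moreover have "(\<Union>n. C n) = B m" unfolding B_def C_def by fastforce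
      ultimately have lim: "(\<lambda>n. prob (C n)) \<longlonglongrightarrow> prob (B m)" by simp
      have "prob (C n) \<le> (suminf v - (\<Sum>i<m. v i)) / \<epsilon>\<^sup>2" for n
      proof -
        have "prob (C n) \<le> (\<Sum>i=m..<n. v i) / \<epsilon>\<^sup>2"
          unfolding C_def v_def by (rule Kolmogorov_maximal_inequality[OF indep sq mean \<open>\<epsilon> > 0\<close>])
        also have "(\<Sum>i=m..<n. v i) \<le> suminf v - (\<Sum>i<m. v i)"
        proof -
          have "(\<Sum>i<m. v i) + (\<Sum>i=m..<n. v i) = sum v ({..<m} \<union> {m..<n})"
            by (subst sum.union_disjoint) auto
          also have "\<dots> \<le> suminf v" using v0 by (intro sum_le_suminf[OF sv]) auto
          finally show ?thesis by simp
        qed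
        finally show ?thesis by (simp add: divide_right_mono)
      qed
      then show ?thesis using LIMSEQ_le_const2[OF lim] by blast
    qed
    have "(\<lambda>m. (suminf v - (\<Sum>i<m. v i)) / \<epsilon>\<^sup>2) \<longlonglongrightarrow> (suminf v - suminf v) / \<epsilon>\<^sup>2"
      by (intro tendsto_intros summable_LIMSEQ sv) (use that in auto)
    then have lim0: "(\<lambda>m. (suminf v - (\<Sum>i<m. v i)) / \<epsilon>\<^sup>2) \<longlonglongrightarrow> 0" by simp
    have "prob (\<Inter>m. B m) \<le> (suminf v - (\<Sum>i<m. v i)) / \<epsilon>\<^sup>2" for m
      by (rule order_trans[OF finite_measure_mono B[of m]]) auto
    then have "prob (\<Inter>m. B m) \<le> 0"
      using LIMSEQ_le_const[OF lim0] by blast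
    then have "prob (\<Inter>m. B m) = 0" by (simp add: measure_le_0_iff)
    then have "AE \<omega> in M. \<omega> \<notin> (\<Inter>m. B m)"
      by (intro AE_not_in) (auto simp: emeasure_eq_measure)
    then show ?thesis
      using AE_space by eventually_elim (simp add: B_def, metis not_le)
  qed
  \<comment> \<open>Only countably many tolerances are used, so that the exceptional null sets can
    be united.\<close>
  have "AE \<omega> in M. \<forall>p. \<exists>m. \<forall>k\<ge>m. \<bar>\<Sum>i=m..<k. X i \<omega>\<bar> < inverse (real (Suc p))"
    by (subst AE_all_countable) (auto intro!: tail)
  then show ?thesis
  proof eventually_elim
    case (elim \<omega>)
    show ?case
      unfolding summable_Cauchy
    proof (intro allI impI)
      fix e :: real assume "e > 0"
      then obtain p where p: "inverse (real (Suc p)) < e / 2"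
        using reals_Archimedean[of "e/2"] by auto
      obtain m where m: "\<And>k. k \<ge> m \<Longrightarrow> \<bar>\<Sum>i=m..<k. X i \<omega>\<bar> < inverse (real (Suc p))"
        using elim by blast
      have "norm (\<Sum>i=a..<b. X i \<omega>) < e" if "a \<ge> m" for a b
      proof (cases "a \<le> b")
        case True
        then have "(\<Sum>i=a..<b. X i \<omega>) = (\<Sum>i=m..<b. X i \<omega>) - (\<Sum>i=m..<a. X i \<omega>)"
          using that by (simp add: sum_diff_nat_ivl)
        then show ?thesis
          using m[of a] m[of b] that True p by (auto simp: abs_if split: if_splits)
      qed (use \<open>e > 0\<close> in auto)
      then show "\<exists>N. \<forall>m\<ge>N. \<forall>n. norm (\<Sum>i=m..<n. X i \<omega>) < e" by blast
    qed
  qed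
qed

end

section \<open>Asymptotics of the coefficients\<close>

text \<open>Division by k^p reduces the claim to y <= y^p for y = (k - 1)/k in [0,1].\<close>

lemma powr_diff_upper:
  fixes p k :: real
  assumes "0 < p" "p \<le> 1" "1 \<le> k"
  shows "k powr p - (k - 1) powr p \<le> k powr (p - 1)"
proof -
  define y where "y = (k - 1) / k"
  have y: "0 \<le> y" "y \<le> 1" and ky: "k - 1 = k * y"
    using assms by (auto simp: y_def)
  have "y \<le> y powr p"
    using powr_mono'[of p 1 y] y assms by (cases "y = 0") auto
  then have "k powr p * y \<le> (k - 1) powr p"
    unfolding ky using y assms by (simp add: powr_mult mult_left_mono)
  moreover have "k powr p * y = k powr p - k powr (p - 1)"
    using assms by (simp add: y_def powr_diff field_simps)
  ultimately show ?thesis by simp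
qed

text \<open>Division by k^p reduces the claim to y^p <= p y + 1 - p, the tangent bound at 1 for a
  concave power, which is Young's inequality with weights p and 1 - p.\<close>

lemma powr_diff_lower:
  fixes p k :: real
  assumes "0 < p" "p < 1" "1 \<le> k"
  shows "p * k powr (p - 1) \<le> k powr p - (k - 1) powr p"
proof -
  define y where "y = (k - 1) / k"
  have y: "0 \<le> y" and ky: "k - 1 = k * y"
    using assms by (auto simp: y_def)
  have "y powr p \<le> p * y + (1 - p)"
    using Youngs_inequality_0[of p "1 - p" y 1] y assms by (cases "y = 0") auto
  then have "(k - 1) powr p \<le> k powr p * (p * y + (1 - p))"
    unfolding ky using y assms by (simp add: powr_mult mult_left_mono)
  also have "\<dots> = k powr p - p * k powr (p - 1)"
    using assms by (simp add: y_def powr_diff field_simps)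
  finally show ?thesis by simp
qed

text \<open>The integrand may be unbounded at an endpoint, as powers with negative exponent are. For
  a nonnegative integrand, continuity of the antiderivative up to the endpoints yields integrability
  as well as the value.\<close>

lemma FTC_nonneg_Ioo:
  fixes f F :: "real \<Rightarrow> real"
  assumes "c < d" and F: "continuous_on {c..d} F"
    and "\<And>x. c < x \<Longrightarrow> x < d \<Longrightarrow> DERIV F x :> f x"
    and "\<And>x. c < x \<Longrightarrow> x < d \<Longrightarrow> isCont f x"
    and "\<And>x. c < x \<Longrightarrow> x < d \<Longrightarrow> 0 \<le> f x"
  shows "set_integrable lborel {c<..<d} f" and "(LBINT x:{c<..<d}. f x) = F d - F c"
proof -
  have "(F \<longlongrightarrow> F c) (at_right c)" "(F \<longlongrightarrow> F d) (at_left d)"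
    using F \<open>c < d\<close> by (auto simp: continuous_on_Icc_at_rightD continuous_on_Icc_at_leftD)
  then have lims: "((F \<circ> real_of_ereal) \<longlongrightarrow> F c) (at_right (ereal c))"
    "((F \<circ> real_of_ereal) \<longlongrightarrow> F d) (at_left (ereal d))"
    by (simp_all add: ereal_tendsto_simps)
  have "set_integrable lborel (einterval c d) f" "(LBINT x=c..d. f x) = F d - F c"
    by (rule interval_integral_FTC_nonneg[of "ereal c" "ereal d" F f "F c" "F d"];
        use assms lims in auto)+
  then show "set_integrable lborel {c<..<d} f" "(LBINT x:{c<..<d}. f x) = F d - F c"
    using \<open>c < d\<close> by (simp_all add: interval_integral_Ioo)
qed

lemma powr_shift_integral:
  fixes p s c d :: real
  assumes "-1 < p" "c < d" "0 \<le> c + s"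
  shows "set_integrable lborel {c<..<d} (\<lambda>x. (x + s) powr p)"
    and "(LBINT x:{c<..<d}. (x + s) powr p) = ((d + s) powr (p + 1) - (c + s) powr (p + 1)) / (p + 1)"
proof -
  let ?F = "\<lambda>x. (x + s) powr (p + 1) / (p + 1)"
  have c: "continuous_on {c..d} ?F"
    using assms by (intro continuous_intros continuous_on_powr') auto
  have d: "DERIV ?F x :> (x + s) powr p" if "c < x" for x
    using that assms by (auto intro!: derivative_eq_intros)
  have i: "isCont (\<lambda>x. (x + s) powr p) x" if "c < x" for x
    using that assms by (intro continuous_intros) auto
  note * = FTC_nonneg_Ioo[OF \<open>c < d\<close> c d i powr_ge_zero]
  show "set_integrable lborel {c<..<d} (\<lambda>x. (x + s) powr p)"
    by (rule *(1))
  show "(LBINT x:{c<..<d}. (x + s) powr p) = ((d + s) powr (p + 1) - (c + s) powr (p + 1)) / (p + 1)"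
    using *(2) by (simp add: diff_divide_distrib)
qed

section \<open>Bounds and limits of the double integrals\<close>

text \<open>Here \<open>a\<close> stands for H - 1/2. The arguments \<open>n\<close> and
  \<open>i\<close> are real, so that i = n - k can be substituted without truncated
  subtraction.\<close>

definition inner_integral :: "real \<Rightarrow> real \<Rightarrow> real \<Rightarrow> real" where
  "inner_integral a n x = (LBINT v:{0<..<1}. (v + n - 1) powr a * (v + n - 1 - x) powr (a - 1))"

definition double_integral :: "real \<Rightarrow> real \<Rightarrow> real \<Rightarrow> real" where
  "double_integral a n i = (LBINT x:{i - 1<..<i}. x powr - a * inner_integral a n x)"

text \<open>The closed form of the integral of (k + v - u)^(a-1) over u and v in [0,1]: a second
  central difference of x^(a+1) divided by a (a + 1).\<close>

definition limit_integral :: "real \<Rightarrow> real \<Rightarrow> real" where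
  "limit_integral a k = ((k + 1) powr (a + 1) + (k - 1) powr (a + 1) - 2 * k powr (a + 1)) / (a * (a + 1))"

text \<open>For v in (0,1) the factor (v + n - 1)^a lies between (n - 1)^a and n^a, and the
  remaining factor integrates exactly to \<open>w\<close>.\<close>

lemma inner_integral_bounds:
  fixes a n x :: real
  assumes "0 < a" "a < 1" "0 \<le> x" "x < n - 1"
  defines "w \<equiv> ((n - x) powr a - (n - 1 - x) powr a) / a"
  shows "(n - 1) powr a * w \<le> inner_integral a n x" and "inner_integral a n x \<le> n powr a * w"
proof -
  have int: "set_integrable lborel {0<..<1} (\<lambda>v. (v + n - 1 - x) powr (a - 1))"
    and val: "(LBINT v:{0<..<1}. (v + n - 1 - x) powr (a - 1)) = w"
    using powr_shift_integral[of "a - 1" 0 1 "n - 1 - x"] assms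
    by (simp_all add: w_def algebra_simps)
  have up: "set_integrable lborel {0<..<1} (\<lambda>v. n powr a * (v + n - 1 - x) powr (a - 1))"
    and lo: "set_integrable lborel {0<..<1} (\<lambda>v. (n - 1) powr a * (v + n - 1 - x) powr (a - 1))"
    using int by auto
  have mid: "set_integrable lborel {0<..<1} (\<lambda>v. (v + n - 1) powr a * (v + n - 1 - x) powr (a - 1))"
  proof (rule set_integrable_bound[OF up])
    show "set_borel_measurable lborel {0<..<1} (\<lambda>v. (v + n - 1) powr a * (v + n - 1 - x) powr (a - 1))"
      unfolding set_borel_measurable_def by measurable
  qed (use assms in \<open>auto intro!: mult_right_mono powr_mono2\<close>)
  have "(LBINT v:{0<..<1}. (n - 1) powr a * (v + n - 1 - x) powr (a - 1)) \<le> inner_integral a n x"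
    unfolding inner_integral_def using assms
    by (intro set_integral_mono lo mid mult_right_mono powr_mono2) auto
  then show "(n - 1) powr a * w \<le> inner_integral a n x" using val by simp
  have "inner_integral a n x \<le> (LBINT v:{0<..<1}. n powr a * (v + n - 1 - x) powr (a - 1))"
    unfolding inner_integral_def using assms
    by (intro set_integral_mono up mid mult_right_mono powr_mono2) auto
  then show "inner_integral a n x \<le> n powr a * w" using val by simp
qed

lemma inner_integral_upper:
  fixes a n x :: real
  assumes "0 < a" "a < 1" "0 \<le> x" "x < n - 1"
  shows "inner_integral a n x \<le> n powr a * ((n - x) powr (a - 1) / a)"
proof -
  have "(n - x) powr a - (n - 1 - x) powr a \<le> (n - x) powr (a - 1)"
    using powr_diff_upper[of a "n - x"] assms by (simp add: algebra_simps)
  then show ?thesis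
    using assms by (intro order_trans[OF inner_integral_bounds(2)] mult_left_mono divide_right_mono) auto
qed

lemma inner_integral_nonneg: "0 \<le> inner_integral a n x"
  unfolding inner_integral_def set_lebesgue_integral_def
  by (intro Bochner_Integration.integral_nonneg) (auto simp: indicator_def)

lemma borel_measurable_inner_integral [measurable]: "inner_integral a n \<in> borel_measurable borel"
  unfolding inner_integral_def set_lebesgue_integral_def by measurable

text \<open>This includes \<open>i = 1\<close>, where the integrand is singular at 0 but integrable
  because a < 1.\<close>

lemma powr_integral_unit:
  fixes a i :: real
  assumes "0 < a" "a < 1" "1 \<le> i"
  shows "set_integrable lborel {i - 1<..<i} (\<lambda>x. x powr - a)"
    and "(LBINT x:{i - 1<..<i}. x powr - a) \<le> i powr - a / (1 - a)"
  using powr_shift_integral[of "-a" "i - 1" i 0] powr_diff_upper[of "1 - a" i] assms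
  by (auto simp: divide_right_mono)

text \<open>The factor (n - x)^(a-1) increases with x and is replaced by its value at x = i. The
  factor x^(-a) has to stay, since it is unbounded when \<open>i = 1\<close>.\<close>

lemma double_integrand_upper:
  fixes a n i x :: real
  assumes "0 < a" "a < 1" "1 \<le> i" "i \<le> n - 1" "i - 1 < x" "x < i"
  shows "x powr - a * inner_integral a n x \<le> n powr a * ((n - i) powr (a - 1) / a) * x powr - a"
proof -
  have "inner_integral a n x \<le> n powr a * ((n - x) powr (a - 1) / a)"
    using assms by (intro inner_integral_upper) auto
  also have "\<dots> \<le> n powr a * ((n - i) powr (a - 1) / a)"
    using assms by (intro mult_left_mono divide_right_mono powr_mono2') auto
  finally show ?thesis by (subst mult.commute) (rule mult_right_mono[OF _ powr_ge_zero])
qed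

lemma double_integrand_integrable:
  fixes a n i :: real
  assumes "0 < a" "a < 1" "1 \<le> i" "i \<le> n - 1"
  shows "set_integrable lborel {i - 1<..<i} (\<lambda>x. x powr - a * inner_integral a n x)"
proof (rule set_integrable_bound)
  show "set_integrable lborel {i - 1<..<i} (\<lambda>x. n powr a * ((n - i) powr (a - 1) / a) * x powr - a)"
    using powr_integral_unit(1)[of a i] assms by auto
  show "set_borel_measurable lborel {i - 1<..<i} (\<lambda>x. x powr - a * inner_integral a n x)"
    unfolding set_borel_measurable_def by measurable
  show "AE x in lborel. x \<in> {i - 1<..<i} \<longrightarrow> norm (x powr - a * inner_integral a n x)
      \<le> norm (n powr a * ((n - i) powr (a - 1) / a) * x powr - a)"
    using double_integrand_upper[OF assms] assms
    by (intro AE_I2) (auto simp: abs_mult inner_integral_nonneg)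
qed

text \<open>This is the uniform estimate behind the domination argument. Unlike the sandwich further
  down, it also covers \<open>i = 1\<close>.\<close>

lemma double_integral_upper:
  fixes a n i :: real
  assumes "0 < a" "a < 1" "1 \<le> i" "i \<le> n - 1"
  shows "double_integral a n i \<le> n powr a * i powr - a * (n - i) powr (a - 1) / (a * (1 - a))"
proof -
  let ?c = "n powr a * ((n - i) powr (a - 1) / a)"
  have "double_integral a n i \<le> (LBINT x:{i - 1<..<i}. ?c * x powr - a)"
    unfolding double_integral_def
    using assms powr_integral_unit(1)[of a i] double_integrand_upper[OF assms]
    by (intro set_integral_mono double_integrand_integrable) auto
  also have "\<dots> = ?c * (LBINT x:{i - 1<..<i}. x powr - a)"
    by simp
  also have "\<dots> \<le> ?c * (i powr - a / (1 - a))"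
    using assms by (intro mult_left_mono powr_integral_unit(2)) auto
  also have "\<dots> = n powr a * i powr - a * (n - i) powr (a - 1) / (a * (1 - a))"
    by simp
  finally show ?thesis .
qed

lemma double_integral_nonneg: "0 \<le> double_integral a n i"
  unfolding double_integral_def set_lebesgue_integral_def
  by (intro Bochner_Integration.integral_nonneg) (auto simp: indicator_def inner_integral_nonneg)

text \<open>The function \<open>w\<close> is a difference quotient of the power a, so one more
  integration produces the second difference. The case \<open>i = n - 1\<close> has a base vanishing
  at the right endpoint, hence the use of interior derivatives only.\<close>

lemma limit_integral_eq:
  fixes a n i :: real
  assumes "0 < a" "a < 1" "i \<le> n - 1"
  defines "w \<equiv> \<lambda>x. ((n - x) powr a - (n - 1 - x) powr a) / a"
  shows "set_integrable lborel {i - 1<..<i} w"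
    and "(LBINT x:{i - 1<..<i}. w x) = limit_integral a (n - i)"
proof -
  let ?F = "\<lambda>x. ((n - 1 - x) powr (a + 1) - (n - x) powr (a + 1)) / (a * (a + 1))"
  have c: "continuous_on {i - 1..i} ?F"
    using assms by (intro continuous_intros continuous_on_powr') auto
  have d: "DERIV ?F x :> w x" if "i - 1 < x" "x < i" for x
    using that assms unfolding w_def
    by (auto intro!: derivative_eq_intros simp: divide_simps) (auto simp: algebra_simps)
  have i: "isCont w x" if "i - 1 < x" "x < i" for x
    unfolding w_def using that assms by (intro continuous_intros) auto
  have p: "0 \<le> w x" if "i - 1 < x" "x < i" for x
    unfolding w_def using that assms(1-3) by (intro divide_nonneg_nonneg) (auto intro!: powr_mono2)
  note * = FTC_nonneg_Ioo[OF _ c d i p]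
  show "set_integrable lborel {i - 1<..<i} w"
    by (rule *(1)) auto
  have "(LBINT x:{i - 1<..<i}. w x) = ?F i - ?F (i - 1)" by (rule *(2)) auto
  also have "\<dots> = limit_integral a (n - i)"
    by (simp add: limit_integral_def diff_divide_distrib add_divide_distrib algebra_simps)
  finally show "(LBINT x:{i - 1<..<i}. w x) = limit_integral a (n - i)" .
qed

text \<open>On the unit interval x^(-a) lies between i^(-a) and (i - 1)^(-a), and the inner integral
  is \<open>w\<close> up to a factor between (n - 1)^a and n^a. The case \<open>i = 1\<close> has to
  be excluded: \<open>0 powr - a\<close> is 0, which would not bound x^(-a) from above.\<close>

lemma double_integral_sandwich:
  fixes a n i :: real
  assumes "0 < a" "a < 1" "1 < i" "i \<le> n - 1"
  shows "(n - 1) powr a * i powr - a * limit_integral a (n - i) \<le> double_integral a n i"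
    and "double_integral a n i \<le> n powr a * (i - 1) powr - a * limit_integral a (n - i)"
proof -
  define w where "w = (\<lambda>x. ((n - x) powr a - (n - 1 - x) powr a) / a)"
  have w: "set_integrable lborel {i - 1<..<i} w" "(LBINT x:{i - 1<..<i}. w x) = limit_integral a (n - i)"
    unfolding w_def by (rule limit_integral_eq; use assms in simp)+
  have int: "set_integrable lborel {i - 1<..<i} (\<lambda>x. x powr - a * inner_integral a n x)"
    using assms by (intro double_integrand_integrable) auto
  have w0: "0 \<le> w x" if "i - 1 < x" "x < i" for x
    unfolding w_def using that assms by (intro divide_nonneg_nonneg) (auto intro!: powr_mono2)
  have inner: "(n - 1) powr a * w x \<le> inner_integral a n x" "inner_integral a n x \<le> n powr a * w x"
    if "i - 1 < x" "x < i" for x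
    unfolding w_def by (rule inner_integral_bounds; use that assms in simp)+
  have "(LBINT x:{i - 1<..<i}. (n - 1) powr a * i powr - a * w x) \<le> double_integral a n i"
    unfolding double_integral_def
  proof (intro set_integral_mono int)
    fix x assume x: "x \<in> {i - 1<..<i}"
    have "i powr - a * ((n - 1) powr a * w x) \<le> x powr - a * inner_integral a n x"
      using x assms w0 inner by (intro mult_mono powr_mono2') (auto simp: inner_integral_nonneg)
    then show "(n - 1) powr a * i powr - a * w x \<le> x powr - a * inner_integral a n x"
      by (simp add: mult_ac)
  qed (use w in auto)
  then show "(n - 1) powr a * i powr - a * limit_integral a (n - i) \<le> double_integral a n i"
    using w by simp
  have "double_integral a n i \<le> (LBINT x:{i - 1<..<i}. n powr a * (i - 1) powr - a * w x)"
    unfolding double_integral_def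
  proof (intro set_integral_mono int)
    fix x assume x: "x \<in> {i - 1<..<i}"
    have "x powr - a * inner_integral a n x \<le> (i - 1) powr - a * (n powr a * w x)"
      using x assms w0 inner by (intro mult_mono powr_mono2') (auto simp: inner_integral_nonneg)
    then show "x powr - a * inner_integral a n x \<le> n powr a * (i - 1) powr - a * w x"
      by (simp add: mult_ac)
  qed (use w in auto)
  then show "double_integral a n i \<le> n powr a * (i - 1) powr - a * limit_integral a (n - i)"
    using w by simp
qed

lemma double_integral_tendsto:
  fixes a k :: real
  assumes "0 < a" "a < 1" "1 \<le> k"
  shows "(\<lambda>n. double_integral a (real n) (real n - k)) \<longlonglongrightarrow> limit_integral a k"
proof (rule tendsto_sandwich)
  \<comment> \<open>The threshold on \<open>n\<close> guarantees \<open>real n - k > 1\<close>, as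
    the sandwich demands.\<close>
  show "\<forall>\<^sub>F n in sequentially. (real n - 1) powr a * (real n - k) powr - a * limit_integral a k
      \<le> double_integral a (real n) (real n - k)"
    using eventually_gt_at_top[of "nat \<lceil>k + 1\<rceil>"]
  proof eventually_elim
    case (elim n)
    then show ?case using double_integral_sandwich(1)[of a "real n - k" "real n"] assms by simp linarith
  qed
  show "\<forall>\<^sub>F n in sequentially. double_integral a (real n) (real n - k)
      \<le> real n powr a * (real n - k - 1) powr - a * limit_integral a k"
    using eventually_gt_at_top[of "nat \<lceil>k + 1\<rceil>"]
  proof eventually_elim
    case (elim n)
    then show ?case using double_integral_sandwich(2)[of a "real n - k" "real n"] assms by simp linarith
  qed
  have "(\<lambda>n::nat. (real n - 1) powr a * (real n - k) powr - a) \<longlonglongrightarrow> 1"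
    using assms by real_asymp
  from tendsto_mult[OF this tendsto_const[of "limit_integral a k"]]
  show "(\<lambda>n. (real n - 1) powr a * (real n - k) powr - a * limit_integral a k) \<longlonglongrightarrow> limit_integral a k"
    by simp
  have "(\<lambda>n::nat. real n powr a * (real n - k - 1) powr - a) \<longlonglongrightarrow> 1"
    using assms by real_asymp
  from tendsto_mult[OF this tendsto_const[of "limit_integral a k"]]
  show "(\<lambda>n. real n powr a * (real n - k - 1) powr - a * limit_integral a k) \<longlonglongrightarrow> limit_integral a k"
    by simp
qed

text \<open>Both bounds are inherited from the double integrals by letting n tend to infinity, which
  avoids estimating the second difference directly.\<close>

lemma limit_integral_bounds:
  fixes a k :: real
  assumes "0 < a" "a < 1" "1 \<le> k"
  shows "0 \<le> limit_integral a k" and "limit_integral a k \<le> k powr (a - 1) / (a * (1 - a))"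
proof -
  note lim = double_integral_tendsto[OF assms]
  show "0 \<le> limit_integral a k"
    by (rule LIMSEQ_le_const[OF lim]) (auto simp: double_integral_nonneg)
  have "(\<lambda>n::nat. real n powr a * (real n - k) powr - a) \<longlonglongrightarrow> 1"
    using assms by real_asymp
  from tendsto_mult[OF this tendsto_const[of "k powr (a - 1) / (a * (1 - a))"]]
  have lim2: "(\<lambda>n. real n powr a * (real n - k) powr - a * (k powr (a - 1) / (a * (1 - a))))
      \<longlonglongrightarrow> k powr (a - 1) / (a * (1 - a))" by simp
  show "limit_integral a k \<le> k powr (a - 1) / (a * (1 - a))"
  proof (rule LIMSEQ_le[OF lim lim2], intro exI[of _ "nat \<lceil>k + 1\<rceil>"] allI impI)
    fix n assume n: "n \<ge> nat \<lceil>k + 1\<rceil>"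
    show "double_integral a (real n) (real n - k) \<le> real n powr a * (real n - k) powr - a * (k powr (a - 1) / (a * (1 - a)))"
      using double_integral_upper[of a "real n - k" "real n"] assms n by simp linarith
  qed
qed


section \<open>Summed convergence of the squared coefficients\<close>

text \<open>Each term is at most an increment of x^p / p by \<open>powr_diff_lower\<close>, and the
  increments telescope.\<close>

lemma sum_powr_le:
  fixes p :: real
  assumes "0 < p" "p < 1"
  shows "(\<Sum>i=1..<n. real i powr (p - 1)) \<le> real n powr p / p"
proof -
  have "(\<Sum>i=1..<Suc n. real i powr (p - 1)) \<le> real n powr p / p" for n
  proof (induction n)
    case (Suc n)
    have "p * real (Suc n) powr (p - 1) \<le> real (Suc n) powr p - real n powr p"
      using powr_diff_lower[of p "real (Suc n)"] assms by simp
    then have "real (Suc n) powr (p - 1) \<le> real (Suc n) powr p / p - real n powr p / p"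
      using assms by (simp add: field_simps)
    then show ?case using Suc.IH by simp
  qed simp
  moreover have "(\<Sum>i=1..<n. real i powr (p - 1)) \<le> (\<Sum>i=1..<Suc n. real i powr (p - 1))"
    by (intro sum_mono2) auto
  ultimately show ?thesis by (meson order_trans)
qed

text \<open>The squares are O(k^(2a-2)), and 2a - 2 < -1 exactly because a < 1/2, that is, H <
  1.\<close>

lemma summable_limit_integral_square:
  fixes a :: real
  assumes "0 < a" "a < 1/2"
  shows "summable (\<lambda>k. (limit_integral a (real (Suc k)))\<^sup>2)"
proof (rule summable_comparison_test')
  have "summable (\<lambda>k. real k powr (2 * a - 2))"
    using assms by (subst summable_real_powr_iff) auto
  then show "summable (\<lambda>k. (1 / (a * (1 - a)))\<^sup>2 * real (Suc k) powr (2 * a - 2))"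
    by (subst (asm) summable_Suc_iff[symmetric]) (rule summable_mult)
  fix k :: nat
  have "(limit_integral a (real (Suc k)))\<^sup>2 \<le> (real (Suc k) powr (a - 1) / (a * (1 - a)))\<^sup>2"
    using assms limit_integral_bounds[of a "real (Suc k)"] by (intro power_mono) auto
  also have "\<dots> = (1 / (a * (1 - a)))\<^sup>2 * real (Suc k) powr (2 * a - 2)"
    by (simp add: power_divide power2_eq_square powr_add[symmetric] algebra_simps)
  finally show "norm ((limit_integral a (real (Suc k)))\<^sup>2) \<le> (1 / (a * (1 - a)))\<^sup>2 * real (Suc k) powr (2 * a - 2)"
    by simp
qed

lemma sum_double_integral_square_diff_tendsto:
  fixes a :: real
  assumes a: "0 < a" "a < 1/2"
  shows "(\<lambda>n. \<Sum>k=1..<n. \<bar>(double_integral a (real n) (real n - real k))\<^sup>2 - (limit_integral a (real k))\<^sup>2\<bar>) \<longlonglongrightarrow> 0"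
proof -
  define B where "B = 1 / (a * (1 - a))"
  have B: "B > 0" using a by (simp add: B_def)
  define I where "I = (\<lambda>n k. double_integral a (real n) (real n - real k))"
  define T where "T = (\<lambda>k. limit_integral a (real k))"
  have I0: "0 \<le> I n k" for n k
    unfolding I_def by (rule double_integral_nonneg)
  have I_le: "(I n k)\<^sup>2 \<le> B\<^sup>2 * real n powr (2 * a) * (real n - real k) powr (- 2 * a) * real k powr (2 * a - 2)"
    if "1 \<le> k" "k < n" for n k
  proof -
    have "real k + 1 \<le> real n" using that by linarith
    then have "I n k \<le> B * real n powr a * (real n - real k) powr - a * real k powr (a - 1)"
      using double_integral_upper[of a "real n - real k" "real n"] a that
      by (simp add: I_def B_def mult_ac)
    then have "(I n k)\<^sup>2 \<le> (B * real n powr a * (real n - real k) powr - a * real k powr (a - 1))\<^sup>2"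
      by (intro power_mono I0)
    also have "\<dots> = B\<^sup>2 * real n powr (2 * a) * (real n - real k) powr (- 2 * a) * real k powr (2 * a - 2)"
      using that by (simp add: power_mult_distrib power2_eq_square powr_add[symmetric] algebra_simps)
    finally show ?thesis .
  qed
  have T_le: "(T k)\<^sup>2 \<le> B\<^sup>2 * real k powr (2 * a - 2)" if "1 \<le> k" for k
  proof -
    have "(T k)\<^sup>2 \<le> (B * real k powr (a - 1))\<^sup>2"
      using limit_integral_bounds[of a "real k"] a that by (intro power_mono) (auto simp: T_def B_def)
    then show ?thesis
      by (simp add: power_mult_distrib power2_eq_square powr_add[symmetric] algebra_simps)
  qed
  \<comment> \<open>The majorised family: for \<open>2 * k > n\<close> the difference is replaced by
    the limit square alone, so that one summable bound serves all \<open>n\<close>. For fixed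
    \<open>k\<close> the first case eventually applies. The value 0 at \<open>k = 0\<close> matches
    sums that start at 1.\<close>
  define f where "f = (\<lambda>k n. if k = 0 then 0 else if 2 * k \<le> n then \<bar>(I n k)\<^sup>2 - (T k)\<^sup>2\<bar> else (T k)\<^sup>2)"
  have f_lim: "(\<lambda>n. f k n) \<longlonglongrightarrow> 0" for k
  proof (cases "k = 0")
    case False
    have "(\<lambda>n. I n k) \<longlonglongrightarrow> T k"
      unfolding I_def T_def using a False by (intro double_integral_tendsto) auto
    then have "(\<lambda>n. \<bar>(I n k)\<^sup>2 - (T k)\<^sup>2\<bar>) \<longlonglongrightarrow> \<bar>(T k)\<^sup>2 - (T k)\<^sup>2\<bar>"
      by (intro tendsto_intros)
    moreover have "\<forall>\<^sub>F n in sequentially. \<bar>(I n k)\<^sup>2 - (T k)\<^sup>2\<bar> = f k n"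
      using eventually_ge_at_top[of "2 * k"] by eventually_elim (use False in \<open>simp add: f_def\<close>)
    ultimately show ?thesis by (simp add: tendsto_cong)
  qed (simp add: f_def)
  \<comment> \<open>For \<open>2 * k \<le> n\<close> the quotient n/(n - k) is at most 2, so its
    power 2a is at most 2 and hence at most 4. The constant 5 is this 4 for the square of
    \<open>I n k\<close> plus 1 for that of \<open>T k\<close>.\<close>
  have f_le: "norm (f k n) \<le> 5 * B\<^sup>2 * real k powr (2 * a - 2)" for k n
  proof (cases "1 \<le> k \<and> 2 * k \<le> n")
    case True
    have "real n powr (2 * a) * (real n - real k) powr (- 2 * a) = (real n / (real n - real k)) powr (2 * a)"
      using True by (simp add: powr_divide powr_minus field_simps)
    also have "\<dots> \<le> 2 powr (2 * a)"
      using True a by (intro powr_mono2) (auto simp: divide_simps)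
    also have "\<dots> \<le> 2 powr 1" using a by (intro powr_mono) auto
    finally have "real n powr (2 * a) * (real n - real k) powr (- 2 * a) \<le> 4" by simp
    then have "B\<^sup>2 * real k powr (2 * a - 2) * (real n powr (2 * a) * (real n - real k) powr (- 2 * a))
        \<le> B\<^sup>2 * real k powr (2 * a - 2) * 4"
      by (intro mult_left_mono) auto
    then have "(I n k)\<^sup>2 \<le> 4 * B\<^sup>2 * real k powr (2 * a - 2)"
      using I_le[of k n] True by (simp add: mult_ac)
    then have "\<bar>(I n k)\<^sup>2 - (T k)\<^sup>2\<bar> \<le> 5 * B\<^sup>2 * real k powr (2 * a - 2)"
      using True T_le[of k] zero_le_power2[of "I n k"] zero_le_power2[of "T k"] by linarith
    then show ?thesis
      using True unfolding f_def by simp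
  next
    case False
    have "0 \<le> B\<^sup>2 * real k powr (2 * a - 2)" by simp
    then have "(T k)\<^sup>2 \<le> 5 * B\<^sup>2 * real k powr (2 * a - 2)" if "1 \<le> k"
      using T_le[OF that] by linarith
    then show ?thesis using False unfolding f_def by (auto simp: not_le)
  qed
  have M: "summable (\<lambda>k. 5 * B\<^sup>2 * real k powr (2 * a - 2))"
    using a by (intro summable_mult) (simp add: summable_real_powr_iff)
  have "(\<lambda>n. suminf (\<lambda>k. f k n)) \<longlonglongrightarrow> suminf (\<lambda>k. 0 :: real)"
    using tannerys_theorem[OF f_lim _ M] f_le by (simp add: case_prod_unfold)
  then have near: "(\<lambda>n. suminf (\<lambda>k. f k n)) \<longlonglongrightarrow> 0" by simp
  have far: "(\<lambda>n. 4 * B\<^sup>2 / (1 - 2 * a) * real n powr (2 * a - 1)) \<longlonglongrightarrow> 0"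
  proof -
    have "(\<lambda>n::nat. real n powr (2 * a - 1)) \<longlonglongrightarrow> 0" using a by real_asymp
    then show ?thesis by (rule tendsto_mult_right_zero)
  qed
  have bound: "(\<Sum>k=1..<n. \<bar>(I n k)\<^sup>2 - (T k)\<^sup>2\<bar>)
      \<le> suminf (\<lambda>k. f k n) + 4 * B\<^sup>2 / (1 - 2 * a) * real n powr (2 * a - 1)" for n
  proof -
    let ?c = "4 * B\<^sup>2 * real n powr (4 * a - 2)"
    \<comment> \<open>When \<open>2 * k > n\<close>, k^(2a-2) is at most 4 n^(2a-2). Together with
      n^(2a) this gives the factor n^(4a-2) in \<open>?c\<close>, leaving only the singular factor
      (n - k)^(-2a) to be summed.\<close>
    have summand: "\<bar>(I n k)\<^sup>2 - (T k)\<^sup>2\<bar> \<le> f k n + ?c * real (n - k) powr (- 2 * a)"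
      if k: "k \<in> {1..<n}" for k
    proof (cases "2 * k \<le> n")
      case True
      then show ?thesis using k by (simp add: f_def)
    next
      case False
      have "real k powr (2 * a - 2) \<le> (real n / 2) powr (2 * a - 2)"
        using False a k by (intro powr_mono2') auto
      also have "\<dots> = 2 powr (2 - 2 * a) * real n powr (2 * a - 2)"
        by (simp add: powr_divide powr_diff field_simps)
      also have "\<dots> \<le> 2 powr 2 * real n powr (2 * a - 2)"
        using a by (intro mult_right_mono powr_mono) auto
      finally have "real k powr (2 * a - 2) \<le> 4 * real n powr (2 * a - 2)" by simp
      then have "B\<^sup>2 * real n powr (2 * a) * (real n - real k) powr (- 2 * a) * real k powr (2 * a - 2)
          \<le> B\<^sup>2 * real n powr (2 * a) * (real n - real k) powr (- 2 * a) * (4 * real n powr (2 * a - 2))"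
        by (intro mult_left_mono) auto
      also have "\<dots> = 4 * B\<^sup>2 * (real n powr (2 * a) * real n powr (2 * a - 2)) * (real n - real k) powr (- 2 * a)"
        by simp
      also have "real n powr (2 * a) * real n powr (2 * a - 2) = real n powr (4 * a - 2)"
        by (simp add: powr_add[symmetric])
      finally have "(I n k)\<^sup>2 \<le> ?c * real (n - k) powr (- 2 * a)"
        using I_le[of k n] k by (simp add: of_nat_diff)
      moreover have "f k n = (T k)\<^sup>2" using False k by (simp add: f_def)
      ultimately show ?thesis
        using zero_le_power2[of "I n k"] zero_le_power2[of "T k"] by linarith
    qed
    have sf: "summable (\<lambda>k. f k n)"
      by (rule summable_comparison_test'[OF M f_le])
    have "(\<Sum>k=1..<n. \<bar>(I n k)\<^sup>2 - (T k)\<^sup>2\<bar>) \<le> (\<Sum>k=1..<n. f k n) + ?c * (\<Sum>k=1..<n. real (n - k) powr (- 2 * a))"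
      unfolding sum_distrib_left sum.distrib[symmetric] by (rule sum_mono[OF summand])
    also have "(\<Sum>k=1..<n. f k n) \<le> suminf (\<lambda>k. f k n)"
      by (rule sum_le_suminf[OF sf]) (auto simp: f_def)
    \<comment> \<open>Reversal turns the singular factor into i^(p-1) with p = 1 - 2a > 0. Its sum
      is O(n^(1-2a)), and the exponents add up to 2a - 1 < 0.\<close>
    also have "(\<Sum>k=1..<n. real (n - k) powr (- 2 * a)) = (\<Sum>i=1..<n. real i powr (- 2 * a))"
      by (rule sum.reindex_bij_witness[of _ "\<lambda>i. n - i" "\<lambda>i. n - i"]) auto
    also have "?c * \<dots> \<le> ?c * (real n powr (1 - 2 * a) / (1 - 2 * a))"
      using sum_powr_le[of "1 - 2 * a" n] a by (intro mult_left_mono) auto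
    also have "\<dots> = 4 * B\<^sup>2 / (1 - 2 * a) * (real n powr (4 * a - 2) * real n powr (1 - 2 * a))"
      by simp
    also have "real n powr (4 * a - 2) * real n powr (1 - 2 * a) = real n powr (2 * a - 1)"
      by (simp add: powr_add[symmetric])
    finally show ?thesis by simp
  qed
  have "(\<lambda>n. \<Sum>k=1..<n. \<bar>(I n k)\<^sup>2 - (T k)\<^sup>2\<bar>) \<longlonglongrightarrow> 0"
    by (rule tendsto_sandwich[OF _ _ tendsto_const, rotated 2])
       (use tendsto_add[OF near far] bound in \<open>auto intro!: sum_nonneg always_eventually\<close>)
  then show ?thesis by (simp add: I_def T_def)
qed

section \<open>Rademacher sums\<close>

lemma j_coef_eq:
  "j_coef \<sigma> H n i = \<sigma> * C_H H * double_integral (H - 1/2) (real n) (real i)"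
proof -
  have "H - 1/2 - 1 = H - 3/2" "- (H - 1/2) = 1/2 - H" by simp_all
  then show ?thesis
    unfolding j_coef_def double_integral_def inner_integral_def
    by (simp add: interval_integral_Ioo)
qed

text \<open>With a = H - 1/2 the exponent 2h equals a + 1. The factor a in \<open>C_H\<close>
  cancels against the denominator a (a + 1) of \<open>limit_integral\<close>, leaving
  \<open>g_H\<close>.\<close>

lemma rho_eq:
  assumes "1/2 < H"
  shows "2 * g_H \<sigma> H * rho (h_of H) k = \<sigma> * C_H H * limit_integral (H - 1/2) (real k)"
proof -
  have exponents: "2 * h_of H = H + 1/2" "H - 1/2 + 1 = H + 1/2" by (simp_all add: h_of_def)
  have "2 * rho (h_of H) k = (real k + 1) powr (H + 1/2) + (real k - 1) powr (H + 1/2) - 2 * real k powr (H + 1/2)"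
    unfolding rho_def exponents by simp
  then have "limit_integral (H - 1/2) (real k) = 2 * rho (h_of H) k / ((H - 1/2) * (H + 1/2))"
    unfolding limit_integral_def exponents by simp
  moreover have "H - 1/2 \<noteq> 0" "H + 1/2 \<noteq> 0" using assms by auto
  ultimately show ?thesis
    unfolding g_H_def C_H_def by (simp add: divide_simps) (simp add: mult_ac)
qed

text \<open>Since cosine is even, the difference is controlled by the squares of the arguments. This
  suits coefficients known to be square summable only.\<close>

lemma abs_cos_diff_le: "\<bar>cos x - cos y\<bar> \<le> \<bar>x\<^sup>2 - y\<^sup>2\<bar> / 2" for x y :: real
proof -
  have "\<bar>cos x - cos y\<bar> = 2 * (\<bar>sin ((x + y) / 2)\<bar> * \<bar>sin ((y - x) / 2)\<bar>)"
    by (simp add: cos_diff_cos abs_mult)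
  also have "\<dots> \<le> 2 * (\<bar>(x + y) / 2\<bar> * \<bar>(y - x) / 2\<bar>)"
    by (intro mult_left_mono mult_mono abs_sin_x_le_abs_x) auto
  also have "\<dots> = \<bar>(x + y) * (y - x)\<bar> / 2"
    by (simp add: abs_mult)
  also have "(x + y) * (y - x) = - (x\<^sup>2 - y\<^sup>2)"
    by (simp add: power2_eq_square algebra_simps)
  finally show ?thesis by simp
qed

section \<open>Characteristic functions and convergence of Rademacher sums\<close>

context prob_space
begin

text \<open>The two events exhaust the space up to a null set, so f(Z) is almost surely a two-valued
  simple function. The codomain is general in order to serve real moments and complex exponentials
  alike.\<close>

lemma Rademacher_integral:
  fixes Z :: "'a \<Rightarrow> real" and f :: "real \<Rightarrow> 'b :: {banach, second_countable_topology}"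
  assumes [measurable]: "random_variable borel Z" "f \<in> borel_measurable borel"
    and p: "prob {\<omega> \<in> space M. Z \<omega> = 1} = 1/2" "prob {\<omega> \<in> space M. Z \<omega> = -1} = 1/2"
  shows "integrable M (\<lambda>\<omega>. f (Z \<omega>))"
    and "expectation (\<lambda>\<omega>. f (Z \<omega>)) = (1/2) *\<^sub>R (f 1 + f (-1))"
proof -
  let ?A = "\<lambda>s. {\<omega> \<in> space M. Z \<omega> = s}"
  let ?g = "\<lambda>\<omega>. indicator (?A 1) \<omega> *\<^sub>R f 1 + indicator (?A (-1)) \<omega> *\<^sub>R f (-1)"
  have "prob (?A 1 \<union> ?A (-1)) = 1"
    using p by (subst finite_measure_Union) auto
  then have "AE \<omega> in M. \<omega> \<in> ?A 1 \<union> ?A (-1)"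
    by (subst (asm) prob_eq_1) auto
  then have ae: "AE \<omega> in M. f (Z \<omega>) = ?g \<omega>"
    by eventually_elim (auto simp: indicator_def)
  have A: "integrable M (indicat_real (?A s))" for s
    by (intro integrable_real_indicator) (auto simp: emeasure_eq_measure)
  then have g: "integrable M ?g" by auto
  then show "integrable M (\<lambda>\<omega>. f (Z \<omega>))"
    using ae by (subst integrable_cong_AE[OF _ _ ae]) auto
  have "expectation (\<lambda>\<omega>. f (Z \<omega>)) = expectation ?g"
    using ae by (intro integral_cong_AE) auto
  also have "\<dots> = (1/2) *\<^sub>R (f 1 + f (-1))"
    using A by (subst Bochner_Integration.integral_add) (auto simp: p scaleR_add_right)
  finally show "expectation (\<lambda>\<omega>. f (Z \<omega>)) = (1/2) *\<^sub>R (f 1 + f (-1))" .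
qed

lemma char_Rademacher:
  fixes Z :: "'a \<Rightarrow> real"
  assumes [measurable]: "random_variable borel Z"
    and p: "prob {\<omega> \<in> space M. Z \<omega> = 1} = 1/2" "prob {\<omega> \<in> space M. Z \<omega> = -1} = 1/2"
  shows "char (distr M borel (\<lambda>\<omega>. c * Z \<omega>)) t = complex_of_real (cos (t * c))"
proof -
  have "char (distr M borel (\<lambda>\<omega>. c * Z \<omega>)) t = expectation (\<lambda>\<omega>. iexp (t * (c * Z \<omega>)))"
    unfolding char_def by (subst integral_distr) auto
  also have "\<dots> = (1/2) *\<^sub>R (iexp (t * (c * 1)) + iexp (t * (c * (-1))))"
    by (rule Rademacher_integral(2)[OF _ _ p]) auto
  also have "\<dots> = (1/2) *\<^sub>R (cis (t * c) + cis (- (t * c)))"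
    by (simp add: cis_conv_exp)
  also have "\<dots> = complex_of_real (cos (t * c))"
    by (simp add: complex_eq_iff)
  finally show ?thesis .
qed

lemma char_Rademacher_sum:
  fixes \<xi> :: "nat \<Rightarrow> 'a \<Rightarrow> real"
  assumes indep: "indep_vars (\<lambda>_. borel) \<xi> {1..}"
    and p: "\<And>i. i \<ge> 1 \<Longrightarrow> prob {\<omega> \<in> space M. \<xi> i \<omega> = 1} = 1/2"
      "\<And>i. i \<ge> 1 \<Longrightarrow> prob {\<omega> \<in> space M. \<xi> i \<omega> = -1} = 1/2"
  shows "char (distr M borel (\<lambda>\<omega>. \<Sum>i=1..<n. c i * \<xi> i \<omega>)) t = (\<Prod>i=1..<n. complex_of_real (cos (t * c i)))"
proof -
  have rv: "\<And>i. i \<ge> 1 \<Longrightarrow> random_variable borel (\<xi> i)"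
    using indep by (auto simp: indep_vars_def)
  have "indep_vars (\<lambda>_. borel) (\<lambda>i \<omega>. c i * \<xi> i \<omega>) {1..<n}"
    by (rule indep_vars_compose2[OF indep_vars_subset[OF indep]]) auto
  then have "char (distr M borel (\<lambda>\<omega>. \<Sum>i=1..<n. c i * \<xi> i \<omega>)) t
      = (\<Prod>i=1..<n. char (distr M borel (\<lambda>\<omega>. c i * \<xi> i \<omega>)) t)"
    by (rule char_distr_sum)
  also have "\<dots> = (\<Prod>i=1..<n. complex_of_real (cos (t * c i)))"
    by (intro prod.cong refl char_Rademacher rv p) auto
  finally show ?thesis .
qed

lemma AE_summable_Rademacher:
  fixes \<xi> :: "nat \<Rightarrow> 'a \<Rightarrow> real"
  assumes indep: "indep_vars (\<lambda>_. borel) \<xi> {1..}"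
    and p: "\<And>i. i \<ge> 1 \<Longrightarrow> prob {\<omega> \<in> space M. \<xi> i \<omega> = 1} = 1/2"
      "\<And>i. i \<ge> 1 \<Longrightarrow> prob {\<omega> \<in> space M. \<xi> i \<omega> = -1} = 1/2"
    and "summable (\<lambda>k. (c (Suc k))\<^sup>2)"
  shows "AE \<omega> in M. summable (\<lambda>k. c (Suc k) * \<xi> (Suc k) \<omega>)"
proof (rule AE_summable_indep)
  have rv: "\<And>i. i \<ge> 1 \<Longrightarrow> random_variable borel (\<xi> i)"
    using indep by (auto simp: indep_vars_def)
  \<comment> \<open>The family indexed by \<open>{1..}\<close> is reindexed by all naturals:
    grouping into the singleton blocks \<open>{Suc j}\<close> keeps independence, and the coordinate
    is then read off.\<close>
  have "indep_vars (\<lambda>j. PiM {Suc j} (\<lambda>_. borel)) (\<lambda>j \<omega>. restrict (\<lambda>i. \<xi> i \<omega>) {Suc j}) UNIV"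
    by (rule indep_vars_restrict[OF indep]) (auto simp: disjoint_family_on_def)
  then have "indep_vars (\<lambda>_. borel) (\<lambda>j \<omega>. (\<lambda>x. c (Suc j) * x (Suc j)) (restrict (\<lambda>i. \<xi> i \<omega>) {Suc j})) UNIV"
    by (rule indep_vars_compose2) (auto intro!: borel_measurable_times measurable_component_singleton)
  then show "indep_vars (\<lambda>_. borel) (\<lambda>k \<omega>. c (Suc k) * \<xi> (Suc k) \<omega>) UNIV" by simp
  have R: "integrable M (\<lambda>\<omega>. f (\<xi> (Suc k) \<omega>))" "expectation (\<lambda>\<omega>. f (\<xi> (Suc k) \<omega>)) = (1/2) *\<^sub>R (f 1 + f (-1))"
    if "f \<in> borel_measurable borel" for f :: "real \<Rightarrow> real" and k
    using that by (intro Rademacher_integral rv p; simp)+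
  show "integrable M (\<lambda>\<omega>. (c (Suc k) * \<xi> (Suc k) \<omega>)\<^sup>2)" for k
    by (rule R(1)) simp
  show "expectation (\<lambda>\<omega>. c (Suc k) * \<xi> (Suc k) \<omega>) = 0" for k
    by (subst R(2)[of "\<lambda>x. c (Suc k) * x"]) auto
  have "expectation (\<lambda>\<omega>. (c (Suc k) * \<xi> (Suc k) \<omega>)\<^sup>2) = (c (Suc k))\<^sup>2" for k
    by (subst R(2)[of "\<lambda>x. (c (Suc k) * x)\<^sup>2"]) auto
  then show "summable (\<lambda>k. expectation (\<lambda>\<omega>. (c (Suc k) * \<xi> (Suc k) \<omega>)\<^sup>2))"
    using assms(4) by simp
qed

text \<open>Dominated convergence applies with the constant 1, as the complex exponentials have
  modulus one.\<close>

lemma char_tendsto_of_AE_tendsto: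
  assumes [measurable]: "\<And>n. random_variable borel (X n)" "random_variable borel Y"
    and ae: "AE \<omega> in M. (\<lambda>n. X n \<omega>) \<longlonglongrightarrow> Y \<omega>"
  shows "(\<lambda>n. char (distr M borel (X n)) t) \<longlonglongrightarrow> char (distr M borel Y) t"
proof -
  have "(\<lambda>n. expectation (\<lambda>\<omega>. iexp (t * X n \<omega>))) \<longlonglongrightarrow> expectation (\<lambda>\<omega>. iexp (t * Y \<omega>))"
  proof (rule integral_dominated_convergence[where w = "\<lambda>_. 1"])
    show "AE \<omega> in M. (\<lambda>n. iexp (t * X n \<omega>)) \<longlonglongrightarrow> iexp (t * Y \<omega>)"
      using ae by eventually_elim (intro tendsto_intros)
  qed auto
  then show ?thesis by (simp add: char_def integral_distr)
qed

text \<open>Only laws are compared: \<open>b n (n - k)\<close> multiplies the variable of index n -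
  k whereas \<open>c k\<close> multiplies that of index k, so the two sums need not be close
  pointwise. The partial sums of the limit series serve as the intermediate sequence.\<close>

lemma weak_conv_Rademacher_sums:
  fixes \<xi> :: "nat \<Rightarrow> 'a \<Rightarrow> real" and b :: "nat \<Rightarrow> nat \<Rightarrow> real"
  assumes indep: "indep_vars (\<lambda>_. borel) \<xi> {1..}"
    and p: "\<And>i. i \<ge> 1 \<Longrightarrow> prob {\<omega> \<in> space M. \<xi> i \<omega> = 1} = 1/2"
      "\<And>i. i \<ge> 1 \<Longrightarrow> prob {\<omega> \<in> space M. \<xi> i \<omega> = -1} = 1/2"
    and sq: "summable (\<lambda>k. (c (Suc k))\<^sup>2)"
    and lim: "(\<lambda>n. \<Sum>k=1..<n. \<bar>(b n (n - k))\<^sup>2 - (c k)\<^sup>2\<bar>) \<longlonglongrightarrow> 0"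
  shows "weak_conv_m (\<lambda>n. distr M borel (\<lambda>\<omega>. \<Sum>i=1..<n. b n i * \<xi> i \<omega>))
    (distr M borel (\<lambda>\<omega>. \<Sum>k. c (Suc k) * \<xi> (Suc k) \<omega>))"
proof (rule levy_continuity)
  have rv [measurable]: "i \<ge> 1 \<Longrightarrow> random_variable borel (\<xi> i)" for i
    using indep by (auto simp: indep_vars_def)
  have rvS [measurable]: "random_variable borel (\<lambda>\<omega>. \<Sum>i=1..<n. d i * \<xi> i \<omega>)" for d n
    by (intro borel_measurable_sum borel_measurable_times rv) auto
  have rvL [measurable]: "random_variable borel (\<lambda>\<omega>. \<Sum>k. c (Suc k) * \<xi> (Suc k) \<omega>)"
    by (intro borel_measurable_suminf borel_measurable_times rv) auto
  show "real_distribution (distr M borel (\<lambda>\<omega>. \<Sum>i=1..<n. b n i * \<xi> i \<omega>))" for n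
    by simp
  show "real_distribution (distr M borel (\<lambda>\<omega>. \<Sum>k. c (Suc k) * \<xi> (Suc k) \<omega>))"
    by simp
  fix t
  let ?Y = "\<lambda>n. char (distr M borel (\<lambda>\<omega>. \<Sum>i=1..<n. b n i * \<xi> i \<omega>)) t"
  let ?S = "\<lambda>n. char (distr M borel (\<lambda>\<omega>. \<Sum>i=1..<n. c i * \<xi> i \<omega>)) t"
  have "AE \<omega> in M. summable (\<lambda>k. c (Suc k) * \<xi> (Suc k) \<omega>)"
    by (rule AE_summable_Rademacher[OF indep p sq])
  then have "AE \<omega> in M. (\<lambda>n. \<Sum>i=1..<n. c i * \<xi> i \<omega>) \<longlonglongrightarrow> (\<Sum>k. c (Suc k) * \<xi> (Suc k) \<omega>)"
  proof eventually_elim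
    case (elim \<omega>)
    have "(\<Sum>i=1..<Suc n. c i * \<xi> i \<omega>) = (\<Sum>k<n. c (Suc k) * \<xi> (Suc k) \<omega>)" for n
      using sum.shift_bounds_Suc_ivl[of "\<lambda>i. c i * \<xi> i \<omega>" 0 n] by (simp add: lessThan_atLeast0)
    then have "(\<lambda>n. \<Sum>i=1..<Suc n. c i * \<xi> i \<omega>) \<longlonglongrightarrow> (\<Sum>k. c (Suc k) * \<xi> (Suc k) \<omega>)"
      using summable_LIMSEQ[OF elim] by simp
    then show ?case by (subst (asm) filterlim_sequentially_Suc)
  qed
  then have S: "?S \<longlonglongrightarrow> char (distr M borel (\<lambda>\<omega>. \<Sum>k. c (Suc k) * \<xi> (Suc k) \<omega>)) t"
    by (intro char_tendsto_of_AE_tendsto) auto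
  \<comment> \<open>Reversing the order of the coefficients does not change the product of cosines.\<close>
  have diff: "norm (?Y n - ?S n) \<le> t\<^sup>2 / 2 * (\<Sum>k=1..<n. \<bar>(b n (n - k))\<^sup>2 - (c k)\<^sup>2\<bar>)" for n
  proof -
    have "?Y n = (\<Prod>i=1..<n. complex_of_real (cos (t * b n i)))"
      by (rule char_Rademacher_sum[OF indep p])
    also have "\<dots> = (\<Prod>k=1..<n. complex_of_real (cos (t * b n (n - k))))"
      by (rule prod.reindex_bij_witness[of _ "\<lambda>i. n - i" "\<lambda>i. n - i"]) auto
    finally have "norm (?Y n - ?S n)
        = norm ((\<Prod>k=1..<n. complex_of_real (cos (t * b n (n - k)))) - (\<Prod>k=1..<n. complex_of_real (cos (t * c k))))"
      by (simp only: char_Rademacher_sum[OF indep p])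
    \<comment> \<open>All factors have modulus at most one, so the difference of the products is at
      most the sum of the differences of the factors.\<close>
    also have "\<dots> \<le> (\<Sum>k=1..<n. norm (complex_of_real (cos (t * b n (n - k))) - complex_of_real (cos (t * c k))))"
      by (rule norm_prod_diff) auto
    also have "\<dots> \<le> (\<Sum>k=1..<n. t\<^sup>2 / 2 * \<bar>(b n (n - k))\<^sup>2 - (c k)\<^sup>2\<bar>)"
    proof (rule sum_mono)
      fix k
      have "norm (complex_of_real (cos (t * b n (n - k))) - complex_of_real (cos (t * c k)))
          = \<bar>cos (t * b n (n - k)) - cos (t * c k)\<bar>"
        by (simp only: of_real_diff[symmetric] norm_of_real)
      also have "\<dots> \<le> \<bar>(t * b n (n - k))\<^sup>2 - (t * c k)\<^sup>2\<bar> / 2"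
        by (rule abs_cos_diff_le)
      also have "(t * b n (n - k))\<^sup>2 - (t * c k)\<^sup>2 = t\<^sup>2 * ((b n (n - k))\<^sup>2 - (c k)\<^sup>2)"
        by (simp add: power_mult_distrib algebra_simps)
      finally show "norm (complex_of_real (cos (t * b n (n - k))) - complex_of_real (cos (t * c k)))
          \<le> t\<^sup>2 / 2 * \<bar>(b n (n - k))\<^sup>2 - (c k)\<^sup>2\<bar>"
        by (simp add: abs_mult)
    qed
    finally show ?thesis by (simp add: sum_distrib_left)
  qed
  have "(\<lambda>n. ?Y n - ?S n) \<longlonglongrightarrow> 0"
  proof (rule Lim_null_comparison)
    show "\<forall>\<^sub>F n in sequentially. norm (?Y n - ?S n) \<le> t\<^sup>2 / 2 * (\<Sum>k=1..<n. \<bar>(b n (n - k))\<^sup>2 - (c k)\<^sup>2\<bar>)"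
      using diff by (intro always_eventually allI)
    show "(\<lambda>n. t\<^sup>2 / 2 * (\<Sum>k=1..<n. \<bar>(b n (n - k))\<^sup>2 - (c k)\<^sup>2\<bar>)) \<longlonglongrightarrow> 0"
      using tendsto_mult[OF tendsto_const lim, of "t\<^sup>2 / 2"] by simp
  qed
  from tendsto_add[OF this S]
  show "?Y \<longlonglongrightarrow> char (distr M borel (\<lambda>\<omega>. \<Sum>k. c (Suc k) * \<xi> (Suc k) \<omega>)) t"
    by simp
qed

end

section \<open>Application to the coefficients \<open>j_coef\<close>\<close>

theorem theorem5p4:
  fixes M :: "'a measure" and \<xi> :: "nat \<Rightarrow> 'a \<Rightarrow> real" and H \<sigma> :: real
  assumes "prob_space M"
    and "1/2 < H" and "H < 1" and "\<sigma> > 0"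
    and "prob_space.indep_vars M (\<lambda>_. borel) \<xi> {1..}"
    and "\<And>i. i \<ge> 1 \<Longrightarrow> measure M {\<omega> \<in> space M. \<xi> i \<omega> = 1} = 1/2"
    and "\<And>i. i \<ge> 1 \<Longrightarrow> measure M {\<omega> \<in> space M. \<xi> i \<omega> = -1} = 1/2"
  shows "weak_conv_m (\<lambda>n. distr M borel (Y_n \<sigma> H \<xi> n)) (distr M borel (Y_lim \<sigma> H \<xi>))"
proof -
  interpret prob_space M by fact
  define a where "a = H - 1/2"
  define L where "L = \<sigma> * C_H H"
  have a: "0 < a" "a < 1/2" using assms by (auto simp: a_def)
  define c where "c = (\<lambda>k::nat. L * limit_integral a (real k))"
  have c: "c k = 2 * g_H \<sigma> H * rho (h_of H) k" for k
    using rho_eq[OF assms(2)] by (simp add: c_def L_def a_def)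
  have sq: "summable (\<lambda>k. (c (Suc k))\<^sup>2)"
    unfolding c_def power_mult_distrib using summable_limit_integral_square[OF a] by (rule summable_mult)
  have "(\<lambda>n. L\<^sup>2 * (\<Sum>k=1..<n. \<bar>(double_integral a (real n) (real n - real k))\<^sup>2 - (limit_integral a (real k))\<^sup>2\<bar>)) \<longlonglongrightarrow> L\<^sup>2 * 0"
    by (intro tendsto_mult tendsto_const sum_double_integral_square_diff_tendsto a)
  moreover have "L\<^sup>2 * (\<Sum>k=1..<n. \<bar>(double_integral a (real n) (real n - real k))\<^sup>2 - (limit_integral a (real k))\<^sup>2\<bar>)
      = (\<Sum>k=1..<n. \<bar>(j_coef \<sigma> H n (n - k))\<^sup>2 - (c k)\<^sup>2\<bar>)" for n
    unfolding sum_distrib_left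
  proof (rule sum.cong)
    fix k assume "k \<in> {1..<n}"
    then have "j_coef \<sigma> H n (n - k) = L * double_integral a (real n) (real n - real k)"
      by (simp add: j_coef_eq L_def a_def of_nat_diff)
    then have "(j_coef \<sigma> H n (n - k))\<^sup>2 - (c k)\<^sup>2
        = L\<^sup>2 * ((double_integral a (real n) (real n - real k))\<^sup>2 - (limit_integral a (real k))\<^sup>2)"
      by (simp add: c_def power_mult_distrib algebra_simps)
    then show "L\<^sup>2 * \<bar>(double_integral a (real n) (real n - real k))\<^sup>2 - (limit_integral a (real k))\<^sup>2\<bar>
        = \<bar>(j_coef \<sigma> H n (n - k))\<^sup>2 - (c k)\<^sup>2\<bar>"
      by (simp add: abs_mult)
  qed simp
  ultimately have lim: "(\<lambda>n. \<Sum>k=1..<n. \<bar>(j_coef \<sigma> H n (n - k))\<^sup>2 - (c k)\<^sup>2\<bar>) \<longlonglongrightarrow> 0" by simp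
  have conv: "weak_conv_m (\<lambda>n. distr M borel (\<lambda>\<omega>. \<Sum>i=1..<n. j_coef \<sigma> H n i * \<xi> i \<omega>))
      (distr M borel (\<lambda>\<omega>. \<Sum>k. c (Suc k) * \<xi> (Suc k) \<omega>))"
    by (rule weak_conv_Rademacher_sums[OF assms(5-7) sq lim])
  have rv: "random_variable borel (\<xi> (Suc k))" for k
    using assms(5) by (auto simp: indep_vars_def)
  have "AE \<omega> in M. summable (\<lambda>k. c (Suc k) * \<xi> (Suc k) \<omega>)"
    by (rule AE_summable_Rademacher[OF assms(5-7) sq])
  \<comment> \<open>\<open>Y_lim\<close> has the constant outside the series. It can be moved inside
    where the series converges, hence equality almost everywhere, which is enough for equal
    laws.\<close>
  then have "AE \<omega> in M. Y_lim \<sigma> H \<xi> \<omega> = (\<Sum>k. c (Suc k) * \<xi> (Suc k) \<omega>)"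
  proof eventually_elim
    case (elim \<omega>)
    \<comment> \<open>If \<open>g_H\<close> vanishes, both sides are zero; otherwise the constant
      cancels from summability. No positivity of the Gamma quotient has to be established.\<close>
    then have "g_H \<sigma> H = 0 \<or> summable (\<lambda>k. rho (h_of H) (Suc k) * \<xi> (Suc k) \<omega>)"
      by (auto simp: c mult.assoc summable_cmult_iff)
    then show ?case
      by (auto simp: Y_lim_def c mult.assoc suminf_mult)
  qed
  then have "distr M borel (Y_lim \<sigma> H \<xi>) = distr M borel (\<lambda>\<omega>. \<Sum>k. c (Suc k) * \<xi> (Suc k) \<omega>)"
    using rv by (intro distr_cong_AE) (auto simp: Y_lim_def[abs_def])
  then show ?thesis using conv by (simp add: Y_n_def[abs_def])
qed

end
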